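(* If $0\leq n'<n$, then $$|q_n|>\frac{(1-\varepsilon^2)^2|q_{n'}z_{n'}|}{4\varepsilon^{n-n'}\mu^2}.$$ In particular, $|q_n|>(1-\varepsilon^2)^2/4\varepsilon^n\mu^2$.
   Context: Let $\mathcal{O}=\mathbb{Z}[\tau]$ be the ring of discriminant $\Delta$ in an imaginary quadratic field $K$. An ideal is reduced if it is integral and has minimal norm among integral ideals in its class; $D(z,r)$ is the closed disc of radius $r$ centered at $z$. A nonempty finite $B\subset\mathcal{O}\setminus\{0\}$ is admissible with $\varepsilon\in(0,1)$ if for every reduced ideal $\mathfrak{b}$ with $\mathfrak{b}\cap B\neq\emptyset$, $\mathbb{C}=\bigcup D(a/b,\varepsilon/|b|)$ over $a\in\mathfrak{b}^{-1}$, $b\in\mathfrak{b}\cap B$ with $(a\mathfrak{b},b/\mathfrak{b})$ reduced. Fix such $B,\varepsilon$ and let $\mu=\max_{b\in B}|b|$. Let $S(a,b)=\begin{bmatrix}a&1\\ b&0\end{bmatrix}$, $(M)_1$ the ideal generated by the first-column entries of $M$; matrices act as Möbius transformations. Given $z\in\mathbb{C}$, the continued fraction algorithm sets $M_0=I$, $b_0=1$, and for $n\ge1$ chooses (in any way) $b_n\in B$ and $a_n\in\mathcal{O}\cap D(b_nM_{n-1}^{-1}(z),\varepsilon|b_{n-1}|)$ with $(M_{n-1}S(a_n/b_{n-1},b_n/b_{n-1}))_1$ reduced, and sets $M_n=M_{n-1}S(a_n/b_{n-1},b_n/b_{n-1})$, stopping if $z$ equals the first-column ratio of $M_n$. Let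 $z_n=M_n^{-1}(z)$ and let $p_n,q_n$ be the left-column entries of $M_n$ (so $q_0=0$, $z_0=z$). *)

theory Defs
  imports "HOL-Analysis.Analysis" "HOL-Library.Extended_Nat"
begin

text \<open>
  For a negative integer \<open>\<Delta>\<close> congruent to 0 or 1 modulo 4, \<open>quad_field \<Delta>\<close> is the imaginary
  quadratic field \<open>K\<close> containing the square root of \<open>\<Delta>\<close>, and \<open>quad_ring \<Delta>\<close> is the unique order
  of discriminant \<open>\<Delta>\<close> in it (the full ring of integers exactly when \<open>\<Delta>\<close> is fundamental).
  Both are subsets of the complex numbers.
\<close>

definition quad_field :: "int \<Rightarrow> complex set" where
  "quad_field \<Delta> = {of_rat x + of_rat y * csqrt (of_int \<Delta>) | x y. True}"

definition quad_tau :: "int \<Rightarrow> complex" where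
  "quad_tau \<Delta> = (of_int \<Delta> + csqrt (of_int \<Delta>)) / 2"

definition quad_ring :: "int \<Rightarrow> complex set" where
  "quad_ring \<Delta> = {of_int x + of_int y * quad_tau \<Delta> | x y. True}"

definition gen_ideal :: "int \<Rightarrow> complex set \<Rightarrow> complex set" where
  "gen_ideal \<Delta> S =
     {\<Sum>x\<in>T. c x * x | T c. finite T \<and> T \<subseteq> S \<and> (\<forall>x\<in>T. c x \<in> quad_ring \<Delta>)}"

definition frac_ideal :: "int \<Rightarrow> complex set \<Rightarrow> bool" where
  "frac_ideal \<Delta> I \<longleftrightarrow>
     (\<exists>S. finite S \<and> S \<subseteq> quad_field \<Delta> \<and> I = gen_ideal \<Delta> S) \<and> I \<noteq> {0}"

definition integral_ideal :: "int \<Rightarrow> complex set \<Rightarrow> bool" where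
  "integral_ideal \<Delta> I \<longleftrightarrow> frac_ideal \<Delta> I \<and> I \<subseteq> quad_ring \<Delta>"

definition ideal_norm :: "int \<Rightarrow> complex set \<Rightarrow> nat" where
  "ideal_norm \<Delta> I = card (quad_ring \<Delta> // {(x, y) \<in> quad_ring \<Delta> \<times> quad_ring \<Delta>. x - y \<in> I})"

definition same_class :: "int \<Rightarrow> complex set \<Rightarrow> complex set \<Rightarrow> bool" where
  "same_class \<Delta> I J \<longleftrightarrow> (\<exists>x\<in>quad_field \<Delta> - {0}. J = (*) x ` I)"

definition reduced_ideal :: "int \<Rightarrow> complex set \<Rightarrow> bool" where
  "reduced_ideal \<Delta> I \<longleftrightarrow> integral_ideal \<Delta> I \<and>
     (\<forall>J. integral_ideal \<Delta> J \<and> same_class \<Delta> I J \<longrightarrow> ideal_norm \<Delta> I \<le> ideal_norm \<Delta> J)"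

definition inv_ideal :: "int \<Rightarrow> complex set \<Rightarrow> complex set" where
  "inv_ideal \<Delta> I = {x \<in> quad_field \<Delta>. \<forall>y\<in>I. x * y \<in> quad_ring \<Delta>}"

definition admissible :: "int \<Rightarrow> complex set \<Rightarrow> real \<Rightarrow> bool" where
  "admissible \<Delta> B \<epsilon> \<longleftrightarrow>
     finite B \<and> B \<noteq> {} \<and> B \<subseteq> quad_ring \<Delta> - {0} \<and> 0 < \<epsilon> \<and> \<epsilon> < 1 \<and>
     (\<forall>I. reduced_ideal \<Delta> I \<and> I \<inter> B \<noteq> {} \<longrightarrow>
        UNIV = \<Union> {cball (a / b) (\<epsilon> / cmod b) | a b.
                  a \<in> inv_ideal \<Delta> I \<and> b \<in> I \<inter> B \<and>
                  reduced_ideal \<Delta> (gen_ideal \<Delta> ((*) a ` I \<union> (*) b ` inv_ideal \<Delta> I))})"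

definition S_mat :: "complex \<Rightarrow> complex \<Rightarrow> complex^2^2" where
  "S_mat a b = vector [vector [a, 1], vector [b, 0]]"

definition col1_ideal :: "int \<Rightarrow> complex^2^2 \<Rightarrow> complex set" where
  "col1_ideal \<Delta> M = gen_ideal \<Delta> {M $ 1 $ 1, M $ 2 $ 1}"

text \<open>
  The value of a Moebius transformation at its pole is the point at infinity; here it is the
  junk value 0. For an invertible \<open>M\<close>, the inverse of \<open>M\<close> has its pole at the first-column
  ratio of \<open>M\<close>, so the junk value of \<open>mat_act (matrix_inv M) z\<close> occurs only when \<open>cf_stop z M\<close>
  holds.
\<close>

definition mat_act :: "complex^2^2 \<Rightarrow> complex \<Rightarrow> complex" where
  "mat_act M = moebius (M $ 1 $ 1) (M $ 1 $ 2) (M $ 2 $ 1) (M $ 2 $ 2)"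

text \<open>A first-column ratio with denominator 0 is infinite, hence different from \<open>z\<close>.\<close>

definition cf_stop :: "complex \<Rightarrow> complex^2^2 \<Rightarrow> bool" where
  "cf_stop z M \<longleftrightarrow> M $ 2 $ 1 \<noteq> 0 \<and> z = M $ 1 $ 1 / M $ 2 $ 1"

text \<open>
  \<open>cf_run \<Delta> B \<epsilon> z N a b M\<close>: steps \<open>1, \<dots>, N\<close> of the algorithm with input \<open>z\<close> can be carried out
  with the choices \<open>a\<close>, \<open>b\<close> and yield the matrices \<open>M\<close>. Here \<open>N = \<infinity>\<close> is a run that never stops;
  a finite \<open>N\<close> is a run that stopped after step \<open>N\<close> or an initial segment of a longer run.
  Values of the sequences beyond \<open>N\<close> are unconstrained.
\<close>

definition cf_run ::
  "int \<Rightarrow> complex set \<Rightarrow> real \<Rightarrow> complex \<Rightarrow> enat \<Rightarrow>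
   (nat \<Rightarrow> complex) \<Rightarrow> (nat \<Rightarrow> complex) \<Rightarrow> (nat \<Rightarrow> complex^2^2) \<Rightarrow> bool" where
  "cf_run \<Delta> B \<epsilon> z N a b M \<longleftrightarrow>
     M 0 = mat 1 \<and> b 0 = 1 \<and>
     (\<forall>n\<ge>1. enat n \<le> N \<longrightarrow>
        \<not> cf_stop z (M (n - 1)) \<and>
        b n \<in> B \<and>
        a n \<in> quad_ring \<Delta> \<inter>
          cball (b n * mat_act (matrix_inv (M (n - 1))) z) (\<epsilon> * cmod (b (n - 1))) \<and>
        M n = M (n - 1) ** S_mat (a n / b (n - 1)) (b n / b (n - 1)) \<and>
        reduced_ideal \<Delta> (col1_ideal \<Delta> (M n)))"

definition cf_q :: "(nat \<Rightarrow> complex^2^2) \<Rightarrow> nat \<Rightarrow> complex" where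
  "cf_q M n = M n $ 2 $ 1"

definition cf_z :: "(nat \<Rightarrow> complex^2^2) \<Rightarrow> complex \<Rightarrow> nat \<Rightarrow> complex" where
  "cf_z M z n = mat_act (matrix_inv (M n)) z"

end

theory Submission
  imports Defs
begin

text \<open>
  Put \<open>r n = q n * z - p n\<close>. The algorithm forces \<open>|r n| \<le> \<epsilon> |r (n - 1)|\<close> and
  \<open>r (n - 1) = - z n * r n\<close>, and the determinant identity
  \<open>|q n * r (n - 1) - q (n - 1) * r n| = |b n| \<le> \<mu>\<close> gives by a geometric series
  \<open>|q n| |r (n - 1)| < \<mu> / (1 - \<epsilon>^2)\<close>. In the other direction, \<open>q n * r m - q m * r n\<close> is a
  nonzero element of the order for \<open>m < n\<close>, hence at least \<open>1\<close> in absolute value: otherwise the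
  reduced ideals \<open>(p m, q m)\<close> and \<open>(p n, q n)\<close> would differ by a factor of absolute value less
  than \<open>1\<close>, although ideal norms scale by the square of that absolute value. So \<open>|q n r m| \<ge> 1/2\<close>
  whenever \<open>|q m r n| \<le> 1/2\<close>; the largest such \<open>m\<close> yields
  \<open>|q n| |r k| \<ge> (1 - \<epsilon>^2) / (4 \<epsilon>^(n - k) \<mu>)\<close> for all \<open>k < n\<close>. When \<open>m = n - 1\<close> this needs
  \<open>2 \<epsilon> \<mu> \<ge> 1\<close>, a consequence of the covering property.
\<close>

section \<open>Indices of additive subgroups\<close>

definition add_subgroup :: "'a::ab_group_add set \<Rightarrow> bool" where
  "add_subgroup A \<longleftrightarrow> 0 \<in> A \<and> (\<forall>x\<in>A. \<forall>y\<in>A. x - y \<in> A)"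

text \<open>The relation is the one in \<open>ideal_norm\<close>, so ideal norms are instances by
  unfolding. As \<open>card\<close> is 0 on infinite sets, an infinite index counts as 0.\<close>

definition add_index :: "'a::ab_group_add set \<Rightarrow> 'a set \<Rightarrow> nat" where
  "add_index A C = card (A // {(x, y) \<in> A \<times> A. x - y \<in> C})"

definition transversal :: "'a::ab_group_add set \<Rightarrow> 'a set \<Rightarrow> 'a set \<Rightarrow> bool" where
  "transversal A C T \<longleftrightarrow> T \<subseteq> A \<and> (\<forall>x\<in>A. \<exists>!t. t \<in> T \<and> x - t \<in> C)"

lemma add_subgroup_uminus: "add_subgroup A \<Longrightarrow> x \<in> A \<Longrightarrow> - x \<in> A"
  unfolding add_subgroup_def by (metis diff_0)

lemma add_subgroup_add: "add_subgroup A \<Longrightarrow> x \<in> A \<Longrightarrow> y \<in> A \<Longrightarrow> x + y \<in> A"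
  by (metis add_subgroup_def add_subgroup_uminus diff_minus_eq_add)

lemma add_subgroup_diff_commute: "add_subgroup A \<Longrightarrow> x - y \<in> A \<Longrightarrow> y - x \<in> A"
  by (metis add_subgroup_uminus minus_diff_eq)

lemma add_subgroup_diff_trans:
  "add_subgroup A \<Longrightarrow> x - y \<in> A \<Longrightarrow> y - z \<in> A \<Longrightarrow> x - z \<in> A"
  using add_subgroup_add[of A "x - y" "y - z"] by simp

lemma add_index_eq_card_transversal:
  assumes C: "add_subgroup C" and T: "transversal A C T"
  shows "add_index A C = card T"
proof -
  let ?R = "{(x, y) \<in> A \<times> A. x - y \<in> C}"
  have TA: "T \<subseteq> A" and ex: "\<And>x. x \<in> A \<Longrightarrow> \<exists>t. t \<in> T \<and> x - t \<in> C"
    and uni: "\<And>x t t'. x \<in> A \<Longrightarrow> t \<in> T \<Longrightarrow> t' \<in> T \<Longrightarrow> x - t \<in> C \<Longrightarrow> x - t' \<in> C \<Longrightarrow> t = t'"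
    using T unfolding transversal_def by blast+
  have C0: "0 \<in> C" using C by (simp add: add_subgroup_def)
  have "bij_betw (\<lambda>t. ?R `` {t}) T (A // ?R)"
  proof (rule bij_betwI')
    fix s t assume s: "s \<in> T" and t: "t \<in> T"
    show "(?R `` {s} = ?R `` {t}) = (s = t)"
    proof
      assume eq: "?R `` {s} = ?R `` {t}"
      have "t \<in> ?R `` {t}" using t TA C0 by auto
      then have "s - t \<in> C" using eq by blast
      then show "s = t" using uni[of s s t] s t TA C0 by auto
    qed simp
  next
    fix t assume "t \<in> T"
    then show "?R `` {t} \<in> A // ?R" using TA by (blast intro: quotientI)
  next
    fix X assume "X \<in> A // ?R"
    then obtain x where x: "x \<in> A" "X = ?R `` {x}" by (rule quotientE)
    obtain t where t: "t \<in> T" "x - t \<in> C" using ex x by blast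
    have "x - y \<in> C \<longleftrightarrow> t - y \<in> C" for y
      using t(2) add_subgroup_diff_commute[OF C] add_subgroup_diff_trans[OF C] by metis
    then have "?R `` {x} = ?R `` {t}" using x(1) t(1) TA by auto
    then show "\<exists>t\<in>T. X = ?R `` {t}" using x t by blast
  qed
  then show ?thesis unfolding add_index_def by (rule bij_betw_same_card[symmetric])
qed

lemma transversal_exists:
  assumes C: "add_subgroup C"
  obtains T where "transversal A C T"
proof -
  \<comment> \<open>The predicate depends only on the coset of \<open>x\<close>, so
    \<open>SOME\<close> picks the same representative for all members of a coset.\<close>
  define f where "f x = (SOME y. y \<in> A \<and> x - y \<in> C)" for x
  have C0: "0 \<in> C" using C by (simp add: add_subgroup_def)
  have f: "f x \<in> A \<and> x - f x \<in> C" if "x \<in> A" for x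
    unfolding f_def by (rule someI[of _ x]) (use that C0 in simp)
  have feq: "f x = f y" if "x - y \<in> C" for x y
  proof -
    have "x - w \<in> C \<longleftrightarrow> y - w \<in> C" for w
      using that add_subgroup_diff_commute[OF C] add_subgroup_diff_trans[OF C] by metis
    then show ?thesis by (simp add: f_def)
  qed
  have "transversal A C (f ` A)"
    unfolding transversal_def
  proof (intro conjI ballI)
    show "f ` A \<subseteq> A" using f by blast
    fix x assume x: "x \<in> A"
    show "\<exists>!t. t \<in> f ` A \<and> x - t \<in> C"
    proof (rule ex1I[of _ "f x"])
      fix t assume "t \<in> f ` A \<and> x - t \<in> C"
      then obtain y where y: "y \<in> A" "t = f y" "x - f y \<in> C" by blast
      then have "x - y \<in> C"
        using f[of y] add_subgroup_diff_commute[OF C] add_subgroup_diff_trans[OF C] by metis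
      then show "t = f x" using feq y by metis
    qed (use f x in blast)
  qed
  then show ?thesis using that by blast
qed

text \<open>Tower law: sums of a representative of \<open>A\<close> modulo \<open>B\<close> and one
  of \<open>B\<close> modulo \<open>C\<close> represent \<open>A\<close> modulo \<open>C\<close>.
  With 0 for infinite cardinalities, \<open>card_cartesian_product\<close> handles infinite indices
  as well.\<close>

lemma add_index_mult:
  assumes A: "add_subgroup A" and B: "add_subgroup B" and C: "add_subgroup C"
    and CB: "C \<subseteq> B" and BA: "B \<subseteq> A"
  shows "add_index A C = add_index A B * add_index B C"
proof -
  obtain S where S: "transversal A B S" using transversal_exists[OF B] .
  obtain T where T: "transversal B C T" using transversal_exists[OF C] .
  have SA: "S \<subseteq> A" and exS: "\<And>x. x \<in> A \<Longrightarrow> \<exists>t. t \<in> S \<and> x - t \<in> B"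
    and uniS: "\<And>x t t'. x \<in> A \<Longrightarrow> t \<in> S \<Longrightarrow> t' \<in> S \<Longrightarrow> x - t \<in> B \<Longrightarrow> x - t' \<in> B \<Longrightarrow> t = t'"
    using S unfolding transversal_def by blast+
  have TB: "T \<subseteq> B" and exT: "\<And>x. x \<in> B \<Longrightarrow> \<exists>t. t \<in> T \<and> x - t \<in> C"
    and uniT: "\<And>x t t'. x \<in> B \<Longrightarrow> t \<in> T \<Longrightarrow> t' \<in> T \<Longrightarrow> x - t \<in> C \<Longrightarrow> x - t' \<in> C \<Longrightarrow> t = t'"
    using T unfolding transversal_def by blast+
  have C0: "0 \<in> C" using C by (simp add: add_subgroup_def)
  let ?g = "\<lambda>(s, t). s + t"
  \<comment> \<open>This one fact yields both uniqueness of representatives and injectivity of the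
    sum map.\<close>
  have key: "s = s' \<and> t = t'"
    if x: "x \<in> A" and st: "s \<in> S" "s' \<in> S" "t \<in> T" "t' \<in> T"
      and d: "x - (s + t) \<in> C" "x - (s' + t') \<in> C" for x s s' t t'
  proof -
    have "x - s \<in> B"
      using add_subgroup_add[OF B, of "x - (s + t)" t] d(1) CB TB st by (auto simp: algebra_simps)
    moreover have "x - s' \<in> B"
      using add_subgroup_add[OF B, of "x - (s' + t')" t'] d(2) CB TB st by (auto simp: algebra_simps)
    ultimately have s: "s = s'" using uniS x st by blast
    have "t = t'"
      using uniT[of "x - s" t t'] \<open>x - s \<in> B\<close> st d s by (simp add: diff_diff_eq)
    with s show ?thesis by blast
  qed
  have "transversal A C (?g ` (S \<times> T))"
    unfolding transversal_def
  proof (intro conjI ballI)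
    show "?g ` (S \<times> T) \<subseteq> A" using SA TB BA by (auto intro!: add_subgroup_add[OF A])
    fix x assume x: "x \<in> A"
    obtain s where s: "s \<in> S" "x - s \<in> B" using exS x by blast
    obtain t where t: "t \<in> T" "x - s - t \<in> C" using exT s by blast
    show "\<exists>!w. w \<in> ?g ` (S \<times> T) \<and> x - w \<in> C"
    proof (rule ex1I[of _ "s + t"])
      show "s + t \<in> ?g ` (S \<times> T) \<and> x - (s + t) \<in> C" using s t by (auto simp: diff_diff_eq)
      fix w assume "w \<in> ?g ` (S \<times> T) \<and> x - w \<in> C"
      then show "w = s + t" using key[OF x] s t by (auto simp: diff_diff_eq)
    qed
  qed
  moreover have "inj_on ?g (S \<times> T)"
  proof (rule inj_onI, clarify)
    fix s t s' t' assume st: "s \<in> S" "t \<in> T" "s' \<in> S" "t' \<in> T" "s + t = s' + t'"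
    have "s + t \<in> A" using st SA TB BA add_subgroup_add[OF A] by blast
    then show "s = s' \<and> t = t'" using key[of "s + t" s s' t t'] st C0 by simp
  qed
  ultimately have "add_index A C = card (S \<times> T)"
    by (metis add_index_eq_card_transversal[OF C] card_image)
  then show ?thesis
    by (simp only: add_index_eq_card_transversal[OF B S] add_index_eq_card_transversal[OF C T]
        card_cartesian_product)
qed

text \<open>Needed for two injective additive maps: multiplication by a nonzero number and complex
  conjugation.\<close>

lemma add_index_image:
  fixes f :: "'a::ab_group_add \<Rightarrow> 'b::ab_group_add"
  assumes C: "add_subgroup C" and inj: "inj f" and f: "\<And>x y. f (x - y) = f x - f y"
  shows "add_index (f ` A) (f ` C) = add_index A C"
proof -
  obtain T where T: "transversal A C T" using transversal_exists[OF C] .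
  have mem: "f x - f y \<in> f ` C \<longleftrightarrow> x - y \<in> C" for x y
    using inj_image_mem_iff[OF inj, of "x - y" C] by (simp add: f)
  have "f 0 = 0" using f[of 0 0] by simp
  then have "add_subgroup (f ` C)"
    using C unfolding add_subgroup_def by (auto simp: f[symmetric])
  moreover have "transversal (f ` A) (f ` C) (f ` T)"
    unfolding transversal_def
  proof (intro conjI ballI)
    show "f ` T \<subseteq> f ` A" using T unfolding transversal_def by blast
    fix w assume "w \<in> f ` A"
    then obtain x where x: "x \<in> A" "w = f x" by blast
    then obtain t where t: "t \<in> T" "x - t \<in> C"
      and uni: "\<And>t'. t' \<in> T \<Longrightarrow> x - t' \<in> C \<Longrightarrow> t' = t"
      using T unfolding transversal_def by blast
    show "\<exists>!t. t \<in> f ` T \<and> w - t \<in> f ` C"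
      using t uni mem x(2) by (intro ex1I[of _ "f t"]) blast+
  qed
  ultimately have "add_index (f ` A) (f ` C) = card (f ` T)"
    by (rule add_index_eq_card_transversal)
  also have "card (f ` T) = card T" by (rule card_image[OF inj_on_subset[OF inj]]) simp
  finally show ?thesis using add_index_eq_card_transversal[OF C T] by simp
qed

lemma add_subgroup_scale:
  fixes u :: "'a::field"
  shows "add_subgroup C \<Longrightarrow> add_subgroup ((*) u ` C)"
  by (auto simp: add_subgroup_def right_diff_distrib[symmetric])

lemma add_index_scale:
  fixes u :: "'a::field"
  assumes "add_subgroup C" "u \<noteq> 0"
  shows "add_index ((*) u ` A) ((*) u ` C) = add_index A C"
  using assms by (intro add_index_image) (auto simp: right_diff_distrib inj_def)

section \<open>The quadratic order\<close>

lemma quad_ringI: "of_int x + of_int y * quad_tau \<Delta> \<in> quad_ring \<Delta>"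
  unfolding quad_ring_def by blast

lemma quad_ringE:
  assumes "u \<in> quad_ring \<Delta>"
  obtains x y :: int where "u = of_int x + of_int y * quad_tau \<Delta>"
  using assms unfolding quad_ring_def by blast

lemma of_int_in_quad_ring: "of_int x \<in> quad_ring \<Delta>"
  using quad_ringI[of x 0] by simp

lemma zero_in_quad_ring: "0 \<in> quad_ring \<Delta>"
  using of_int_in_quad_ring[of 0] by simp

lemma one_in_quad_ring: "1 \<in> quad_ring \<Delta>"
  using of_int_in_quad_ring[of 1] by simp

lemma diff_in_quad_ring:
  assumes "u \<in> quad_ring \<Delta>" "v \<in> quad_ring \<Delta>"
  shows "u - v \<in> quad_ring \<Delta>"
proof -
  obtain x y x' y' where "u = of_int x + of_int y * quad_tau \<Delta>"
    "v = of_int x' + of_int y' * quad_tau \<Delta>"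
    using assms by (elim quad_ringE)
  then have "u - v = of_int (x - x') + of_int (y - y') * quad_tau \<Delta>"
    by (simp add: algebra_simps)
  then show ?thesis using quad_ringI by metis
qed

lemma add_subgroup_quad_ring: "add_subgroup (quad_ring \<Delta>)"
  by (simp add: add_subgroup_def zero_in_quad_ring diff_in_quad_ring)

lemmas add_in_quad_ring = add_subgroup_add[OF add_subgroup_quad_ring]

locale quad_order =
  fixes \<Delta> :: int
  assumes neg: "\<Delta> < 0" and disc: "\<Delta> mod 4 \<in> {0, 1}"
begin

text \<open>The congruence on \<Delta> makes the division exact; the quotient is the norm of
  \<open>quad_tau \<Delta>\<close>.\<close>

lemma disc_div: "4 * ((\<Delta>\<^sup>2 - \<Delta>) div 4) = \<Delta>\<^sup>2 - \<Delta>"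
proof -
  obtain k r where "\<Delta> = 4 * k + r" "r = 0 \<or> r = 1"
    using disc by (metis empty_iff insert_iff mult_div_mod_eq)
  then have "4 dvd \<Delta>\<^sup>2 - \<Delta>"
    by (auto simp: power2_eq_square algebra_simps)
  then show ?thesis by simp
qed

lemma csqrt_disc: "csqrt (of_int \<Delta>) = \<i> * of_real (sqrt (- of_int \<Delta>))"
  using csqrt_of_real_nonpos[of "of_int \<Delta>"] neg by simp

lemma tau_eq: "quad_tau \<Delta> = Complex (of_int \<Delta> / 2) (sqrt (- of_int \<Delta>) / 2)"
  by (simp add: quad_tau_def csqrt_disc complex_eq_iff)

lemma cnj_tau: "cnj (quad_tau \<Delta>) = of_int \<Delta> - quad_tau \<Delta>"
  by (simp add: tau_eq complex_eq_iff)

lemma tau_norm: "quad_tau \<Delta> * cnj (quad_tau \<Delta>) = of_int ((\<Delta>\<^sup>2 - \<Delta>) div 4)"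
proof -
  have "(of_int (4 * ((\<Delta>\<^sup>2 - \<Delta>) div 4)) :: real) = of_int (\<Delta>\<^sup>2 - \<Delta>)"
    by (simp only: disc_div)
  moreover have "sqrt (- of_int \<Delta>) * sqrt (- of_int \<Delta>) = - real_of_int \<Delta>" using neg by simp
  ultimately show ?thesis
    by (simp add: tau_eq complex_eq_iff power2_eq_square field_simps)
qed

lemma mult_in_quad_ring:
  assumes "u \<in> quad_ring \<Delta>" "v \<in> quad_ring \<Delta>"
  shows "u * v \<in> quad_ring \<Delta>"
proof -
  obtain x y x' y' where uv: "u = of_int x + of_int y * quad_tau \<Delta>"
    "v = of_int x' + of_int y' * quad_tau \<Delta>"
    using assms by (elim quad_ringE)
  \<comment> \<open>The quadratic equation of \<open>quad_tau \<Delta>\<close>, with trace \<Delta>,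
    obtained by substituting \<open>cnj_tau\<close> into \<open>tau_norm\<close>.\<close>
  have t: "quad_tau \<Delta> * quad_tau \<Delta> = of_int \<Delta> * quad_tau \<Delta> - of_int ((\<Delta>\<^sup>2 - \<Delta>) div 4)"
    using tau_norm by (simp add: cnj_tau algebra_simps)
  have "u * v = of_int x * of_int x' + of_int (x * y' + x' * y) * quad_tau \<Delta>
      + of_int (y * y') * (quad_tau \<Delta> * quad_tau \<Delta>)"
    by (simp add: uv algebra_simps)
  also have "\<dots> = of_int (x * x' - y * y' * ((\<Delta>\<^sup>2 - \<Delta>) div 4))
      + of_int (x * y' + x' * y + y * y' * \<Delta>) * quad_tau \<Delta>"
    unfolding t by (simp add: algebra_simps)
  finally show ?thesis using quad_ringI by metis
qed

lemma cnj_in_quad_ring: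
  assumes "u \<in> quad_ring \<Delta>"
  shows "cnj u \<in> quad_ring \<Delta>"
proof -
  obtain x y where u: "u = of_int x + of_int y * quad_tau \<Delta>" using assms by (elim quad_ringE)
  have "cnj u = of_int (x + y * \<Delta>) + of_int (- y) * quad_tau \<Delta>"
    by (simp add: u cnj_tau algebra_simps)
  then show ?thesis using quad_ringI by metis
qed

lemma cnj_image_quad_ring: "cnj ` quad_ring \<Delta> = quad_ring \<Delta>"
proof
  show "cnj ` quad_ring \<Delta> \<subseteq> quad_ring \<Delta>" using cnj_in_quad_ring by blast
  show "quad_ring \<Delta> \<subseteq> cnj ` quad_ring \<Delta>"
    by (metis cnj_in_quad_ring complex_cnj_cnj image_eqI subsetI)
qed

text \<open>The squared modulus is a quadratic form in the two coordinates, with integer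
  coefficients. This integrality is the source of every lower bound by 1 below.\<close>

lemma norm_square_nat:
  assumes "u \<in> quad_ring \<Delta>"
  obtains n :: nat where "(cmod u)\<^sup>2 = real n"
proof -
  obtain x y where u: "u = of_int x + of_int y * quad_tau \<Delta>" using assms by (elim quad_ringE)
  have "complex_of_real ((cmod u)\<^sup>2) = u * cnj u" by (rule complex_norm_square)
  also have "\<dots> = of_int x * of_int x + of_int (x * y) * (quad_tau \<Delta> + cnj (quad_tau \<Delta>))
      + of_int (y * y) * (quad_tau \<Delta> * cnj (quad_tau \<Delta>))"
    by (simp add: u algebra_simps)
  also have "\<dots> = of_int (x * x + x * y * \<Delta> + y * y * ((\<Delta>\<^sup>2 - \<Delta>) div 4))"
    unfolding tau_norm by (simp add: cnj_tau)
  also have "\<dots> = complex_of_real (of_int (x * x + x * y * \<Delta> + y * y * ((\<Delta>\<^sup>2 - \<Delta>) div 4)))"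
    by simp
  finally have "(cmod u)\<^sup>2 = of_int (x * x + x * y * \<Delta> + y * y * ((\<Delta>\<^sup>2 - \<Delta>) div 4))"
    by (simp only: of_real_eq_iff)
  then obtain k :: int where k: "(cmod u)\<^sup>2 = of_int k" by blast
  then have "k \<ge> 0" by (metis of_int_0_le_iff zero_le_power2)
  then show ?thesis using that[of "nat k"] k by simp
qed

lemma norm_ge_1:
  assumes "u \<in> quad_ring \<Delta>" "u \<noteq> 0"
  shows "1 \<le> cmod u"
proof -
  obtain n :: nat where n: "(cmod u)\<^sup>2 = real n" using norm_square_nat assms(1) .
  then have "n \<noteq> 0" using assms(2) by (intro notI) simp
  then have "1\<^sup>2 \<le> (cmod u)\<^sup>2" using n by simp
  then show ?thesis by (rule power2_le_imp_le) simp
qed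

lemma quotient_in_quad_field:
  assumes "u \<in> quad_ring \<Delta>" "w \<in> quad_ring \<Delta>"
  shows "u / w \<in> quad_field \<Delta>"
proof -
  obtain n :: nat where n: "(cmod w)\<^sup>2 = real n" using norm_square_nat assms(2) .
  have "u * cnj w \<in> quad_ring \<Delta>" using assms mult_in_quad_ring cnj_in_quad_ring by blast
  then obtain x y where xy: "u * cnj w = of_int x + of_int y * quad_tau \<Delta>" by (elim quad_ringE)
  have "u / w = u * cnj w / of_nat n"
    using complex_div_cnj[of u w] n by simp
  also have "\<dots> = of_rat (of_int (2 * x + y * \<Delta>) / (2 * of_nat n))
      + of_rat (of_int y / (2 * of_nat n)) * csqrt (of_int \<Delta>)"
    unfolding xy quad_tau_def
    \<comment> \<open>If \<open>n = 0\<close> then \<open>w = 0\<close>, and both sides are 0 by the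
      convention for division by 0.\<close>
    by (cases "n = 0") (simp_all add: of_rat_divide of_rat_mult of_rat_add field_simps)
  finally show ?thesis unfolding quad_field_def by blast
qed

section \<open>Norms of ideals\<close>

text \<open>Reducing both coordinates modulo \<open>n\<close> gives \<open>n * n\<close>
  representatives. Coordinates are unique because \<open>quad_tau \<Delta>\<close> is not
  real.\<close>

lemma index_nat_multiples:
  assumes "n > 0"
  shows "add_index (quad_ring \<Delta>) ((*) (of_nat n) ` quad_ring \<Delta>) = n\<^sup>2"
proof -
  let ?O = "quad_ring \<Delta>" and ?t = "quad_tau \<Delta>"
  let ?g = "\<lambda>(i, j). of_int i + of_int j * ?t" and ?D = "{0..<int n} \<times> {0..<int n}"
  have inj: "of_int x + of_int y * ?t = of_int x' + of_int y' * ?t \<longleftrightarrow> x = x' \<and> y = y'"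
    for x y x' y' :: int
    using neg by (auto simp: tau_eq complex_eq_iff)
  have mem: "of_int x + of_int y * ?t - (of_int x' + of_int y' * ?t) \<in> (*) (of_nat n) ` ?O \<longleftrightarrow>
      x mod int n = x' mod int n \<and> y mod int n = y' mod int n" (is "?L \<longleftrightarrow> ?R") for x y x' y' :: int
  proof
    assume ?L
    then obtain k l :: int
      where "of_int x + of_int y * ?t - (of_int x' + of_int y' * ?t) = of_nat n * (of_int k + of_int l * ?t)"
      unfolding quad_ring_def by blast
    then have "of_int (x - x') + of_int (y - y') * ?t = of_int (int n * k) + of_int (int n * l) * ?t"
      by (simp add: algebra_simps)
    then have "x - x' = int n * k \<and> y - y' = int n * l" by (simp only: inj)
    then show ?R by (metis dvd_triv_left mod_eq_dvd_iff)
  next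
    assume ?R
    then obtain k l where "x - x' = int n * k" "y - y' = int n * l"
      by (metis dvdE mod_eq_dvd_iff)
    then have "x = x' + int n * k" "y = y' + int n * l" by auto
    then have "of_int x + of_int y * ?t - (of_int x' + of_int y' * ?t)
        = of_nat n * (of_int k + of_int l * ?t)"
      by (simp add: algebra_simps)
    then show ?L using quad_ringI by blast
  qed
  have "add_subgroup ((*) (of_nat n) ` ?O)"
    by (rule add_subgroup_scale[OF add_subgroup_quad_ring])
  moreover have "transversal ?O ((*) (of_nat n) ` ?O) (?g ` ?D)"
    unfolding transversal_def
  proof (intro conjI ballI)
    show "?g ` ?D \<subseteq> ?O" using quad_ringI by auto
    fix u assume "u \<in> ?O"
    then obtain x y where u: "u = of_int x + of_int y * ?t" by (elim quad_ringE)
    show "\<exists>!t. t \<in> ?g ` ?D \<and> u - t \<in> (*) (of_nat n) ` ?O"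
    proof (rule ex1I[of _ "?g (x mod int n, y mod int n)"])
      show "?g (x mod int n, y mod int n) \<in> ?g ` ?D \<and>
          u - ?g (x mod int n, y mod int n) \<in> (*) (of_nat n) ` ?O"
        using assms mem[of x y "x mod int n" "y mod int n"] by (auto simp: u)
      fix t assume "t \<in> ?g ` ?D \<and> u - t \<in> (*) (of_nat n) ` ?O"
      then obtain i j where "i \<in> {0..<int n}" "j \<in> {0..<int n}" "t = of_int i + of_int j * ?t"
        "u - (of_int i + of_int j * ?t) \<in> (*) (of_nat n) ` ?O" by auto
      then show "t = ?g (x mod int n, y mod int n)"
        using mem[of x y i j] by (simp add: u)
    qed
  qed
  ultimately have "add_index ?O ((*) (of_nat n) ` ?O) = card (?g ` ?D)"
    by (rule add_index_eq_card_transversal)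
  also have "\<dots> = card ?D"
    by (rule card_image, rule inj_onI) (auto simp: inj)
  finally show ?thesis by (simp add: card_cartesian_product power2_eq_square)
qed

text \<open>Conjugation preserves the order, so \<open>u\<close> and \<open>cnj u\<close> generate ideals of equal index, and
  the product of the two indices is the index of the ideal generated by the integer \<open>u * cnj u\<close>.\<close>

lemma index_principal:
  assumes u: "u \<in> quad_ring \<Delta>" "u \<noteq> 0"
  shows "real (add_index (quad_ring \<Delta>) ((*) u ` quad_ring \<Delta>)) = (cmod u)\<^sup>2"
proof -
  let ?O = "quad_ring \<Delta>"
  obtain n :: nat where n: "(cmod u)\<^sup>2 = real n" using norm_square_nat u(1) .
  then have n0: "n > 0" using u by (cases "n = 0") auto
  have uu: "u * cnj u = of_nat n"
    using complex_norm_square[of u] n by simp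
  note O = add_subgroup_quad_ring[of \<Delta>]
  have "add_index (cnj ` ?O) (cnj ` (*) u ` ?O) = add_index ?O ((*) u ` ?O)"
    using add_subgroup_scale[OF O] by (intro add_index_image) (auto simp: inj_def)
  moreover have "cnj ` (*) u ` ?O = (*) (cnj u) ` cnj ` ?O" by (simp add: image_image)
  ultimately have c: "add_index ?O ((*) (cnj u) ` ?O) = add_index ?O ((*) u ` ?O)"
    by (simp only: cnj_image_quad_ring)
  have "(*) (of_nat n) ` ?O = (*) u ` (*) (cnj u) ` ?O"
    by (simp add: image_image uu[symmetric] mult.assoc)
  moreover have "(*) u ` (*) (cnj u) ` ?O \<subseteq> (*) u ` ?O"
    using mult_in_quad_ring[OF cnj_in_quad_ring[OF u(1)]] by blast
  moreover have "(*) u ` ?O \<subseteq> ?O" using mult_in_quad_ring[OF u(1)] by blast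
  ultimately have "n\<^sup>2 = add_index ?O ((*) u ` ?O) * add_index ((*) u ` ?O) ((*) u ` (*) (cnj u) ` ?O)"
    unfolding index_nat_multiples[OF n0, symmetric]
    by (simp only:) (intro add_index_mult add_subgroup_scale O)
  also have "\<dots> = (add_index ?O ((*) u ` ?O))\<^sup>2"
    using add_index_scale[OF add_subgroup_scale[OF O] u(2)] c by (simp add: power2_eq_square)
  finally have "n = add_index ?O ((*) u ` ?O)" by simp
  then show ?thesis using n by simp
qed

lemma ideal_norm_eq_index: "ideal_norm \<Delta> I = add_index (quad_ring \<Delta>) I"
  by (simp add: ideal_norm_def add_index_def)

text \<open>Apply the tower law to the order, its multiple by \<open>u\<close>, and \<open>u\<close>
  times \<open>I\<close>: the first index is the squared modulus of \<open>u\<close>, and the second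
  is unchanged by cancelling \<open>u\<close>.\<close>

lemma norm_scale:
  assumes I: "add_subgroup I" "I \<subseteq> quad_ring \<Delta>" and u: "u \<in> quad_ring \<Delta>" "u \<noteq> 0"
  shows "real (ideal_norm \<Delta> ((*) u ` I)) = (cmod u)\<^sup>2 * ideal_norm \<Delta> I"
proof -
  let ?O = "quad_ring \<Delta>"
  note O = add_subgroup_quad_ring[of \<Delta>]
  have "add_index ?O ((*) u ` I) = add_index ?O ((*) u ` ?O) * add_index ((*) u ` ?O) ((*) u ` I)"
    using add_index_mult[OF O add_subgroup_scale[OF O] add_subgroup_scale[OF I(1)]]
      mult_in_quad_ring[OF u(1)] I(2) by blast
  then show ?thesis
    using add_index_scale[OF I(1) u(2)] index_principal[OF u] by (simp add: ideal_norm_eq_index)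
qed

text \<open>Positivity encodes finiteness of the index. The multiples of \<open>u\<close> lie in
  \<open>I\<close> and have finite nonzero index in the order, and the index of \<open>I\<close> is
  a factor of that number.\<close>

lemma norm_pos:
  assumes I: "add_subgroup I" "I \<subseteq> quad_ring \<Delta>" and u: "u \<in> I" "u \<noteq> 0"
    and ideal: "\<And>c. c \<in> quad_ring \<Delta> \<Longrightarrow> c * u \<in> I"
  shows "ideal_norm \<Delta> I > 0"
proof -
  let ?O = "quad_ring \<Delta>"
  note O = add_subgroup_quad_ring[of \<Delta>]
  have "(*) u ` ?O \<subseteq> I" using ideal by (auto simp: mult.commute)
  then have "add_index ?O ((*) u ` ?O) = add_index ?O I * add_index I ((*) u ` ?O)"
    using add_index_mult[OF O I(1) add_subgroup_scale[OF O]] I(2) by blast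
  moreover have "add_index ?O ((*) u ` ?O) \<noteq> 0"
    using index_principal[of u] u I(2) by (intro notI) auto
  ultimately show ?thesis by (simp add: ideal_norm_eq_index)
qed


section \<open>Ideals given by generators, and reduced ideals\<close>

lemma gen_ideal_pair:
  "gen_ideal \<Delta> {u, v} = {c * u + d * v | c d. c \<in> quad_ring \<Delta> \<and> d \<in> quad_ring \<Delta>}"
    (is "_ = ?R")
proof
  show "gen_ideal \<Delta> {u, v} \<subseteq> ?R"
  proof
    fix x assume "x \<in> gen_ideal \<Delta> {u, v}"
    then obtain T c where x: "x = (\<Sum>y\<in>T. c y * y)" and T: "T \<subseteq> {u, v}"
      and c: "\<forall>y\<in>T. c y \<in> quad_ring \<Delta>"
      unfolding gen_ideal_def by blast
    have R: "r * u + s * v \<in> ?R" if "r \<in> quad_ring \<Delta>" "s \<in> quad_ring \<Delta>" for r s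
      using that by blast
    consider "T = {}" | "T = {u}" | "T = {v}" | "T = {u, v}" "u \<noteq> v"
      using T by (cases "u \<in> T"; cases "v \<in> T"; cases "u = v") blast+
    then show "x \<in> ?R"
    proof cases
      case 1
      then show ?thesis using R[OF zero_in_quad_ring zero_in_quad_ring] x by simp
    next
      case 2
      then show ?thesis using R[OF _ zero_in_quad_ring, of "c u"] x c by simp
    next
      case 3
      then show ?thesis using R[OF zero_in_quad_ring, of "c v"] x c by simp
    next
      case 4
      then show ?thesis using R[of "c u" "c v"] x c by simp
    qed
  qed
  show "?R \<subseteq> gen_ideal \<Delta> {u, v}"
  proof clarify
    fix c d assume cd: "c \<in> quad_ring \<Delta>" "d \<in> quad_ring \<Delta>"
    show "c * u + d * v \<in> gen_ideal \<Delta> {u, v}"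
    \<comment> \<open>Generators form a set, so for \<open>u = v\<close> there is only one summand
      and the two coefficients must be merged.\<close>
    proof (cases "u = v")
      case True
      then have "c * u + d * v = (\<Sum>y\<in>{u}. (c + d) * y)" by (simp add: algebra_simps)
      then show ?thesis
        unfolding gen_ideal_def using add_in_quad_ring[OF cd] by (intro CollectI exI[of _ "{u}"]) auto
    next
      case False
      then have "c * u + d * v = (\<Sum>y\<in>{u, v}. (if y = u then c else d) * y)" by simp
      then show ?thesis
        unfolding gen_ideal_def using cd
        by (intro CollectI exI[of _ "{u, v}"] exI[of _ "\<lambda>y. if y = u then c else d"]) auto
    qed
  qed
qed

lemma gen_ideal_one: "gen_ideal \<Delta> {1, 0} = quad_ring \<Delta>"
  unfolding gen_ideal_pair using zero_in_quad_ring by auto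

lemma generators_in_gen_ideal: "u \<in> gen_ideal \<Delta> {u, v}" "v \<in> gen_ideal \<Delta> {u, v}"
proof -
  have "1 * u + 0 * v \<in> gen_ideal \<Delta> {u, v}" "0 * u + 1 * v \<in> gen_ideal \<Delta> {u, v}"
    unfolding gen_ideal_pair using zero_in_quad_ring one_in_quad_ring by blast+
  then show "u \<in> gen_ideal \<Delta> {u, v}" "v \<in> gen_ideal \<Delta> {u, v}" by simp_all
qed

lemma gen_ideal_scale: "gen_ideal \<Delta> {x * u, x * v} = (*) x ` gen_ideal \<Delta> {u, v}"
proof -
  have "c * (x * u) + d * (x * v) = x * (c * u + d * v)" for c d by (simp add: algebra_simps)
  then show ?thesis unfolding gen_ideal_pair by auto
qed

lemma gen_ideal_closed:
  shows gen_ideal_zero: "0 \<in> gen_ideal \<Delta> S"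
    and gen_ideal_diff: "x \<in> gen_ideal \<Delta> S \<Longrightarrow> y \<in> gen_ideal \<Delta> S \<Longrightarrow> x - y \<in> gen_ideal \<Delta> S"
    and gen_ideal_mult: "k \<in> quad_ring \<Delta> \<Longrightarrow> x \<in> gen_ideal \<Delta> S \<Longrightarrow> k * x \<in> gen_ideal \<Delta> S"
proof -
  show "0 \<in> gen_ideal \<Delta> S"
    unfolding gen_ideal_def by (intro CollectI exI[of _ "{}"]) auto
next
  assume "x \<in> gen_ideal \<Delta> S" "y \<in> gen_ideal \<Delta> S"
  then obtain T c T' c' where x: "x = (\<Sum>w\<in>T. c w * w)" "finite T" "T \<subseteq> S" "\<forall>w\<in>T. c w \<in> quad_ring \<Delta>"
    and y: "y = (\<Sum>w\<in>T'. c' w * w)" "finite T'" "T' \<subseteq> S" "\<forall>w\<in>T'. c' w \<in> quad_ring \<Delta>"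
    unfolding gen_ideal_def by blast
  \<comment> \<open>Extending both coefficient families by 0 to \<open>T \<union> T'\<close> allows
    termwise subtraction.\<close>
  define e where "e w = (if w \<in> T then c w else 0) - (if w \<in> T' then c' w else 0)" for w
  have "x = (\<Sum>w\<in>T \<union> T'. (if w \<in> T then c w else 0) * w)"
    unfolding x(1) by (rule sum.mono_neutral_cong_left) (use x y in auto)
  moreover have "y = (\<Sum>w\<in>T \<union> T'. (if w \<in> T' then c' w else 0) * w)"
    unfolding y(1) by (rule sum.mono_neutral_cong_left) (use x y in auto)
  ultimately have "x - y = (\<Sum>w\<in>T \<union> T'. e w * w)"
    by (simp add: e_def sum_subtractf left_diff_distrib)
  moreover have "\<forall>w\<in>T \<union> T'. e w \<in> quad_ring \<Delta>"
    unfolding e_def using x(4) y(4) zero_in_quad_ring by (intro ballI diff_in_quad_ring) auto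
  ultimately show "x - y \<in> gen_ideal \<Delta> S"
    unfolding gen_ideal_def using x(2,3) y(2,3)
    by (intro CollectI exI[of _ "T \<union> T'"] exI[of _ e]) auto
next
  assume k: "k \<in> quad_ring \<Delta>" and "x \<in> gen_ideal \<Delta> S"
  then obtain T c where x: "x = (\<Sum>w\<in>T. c w * w)" "finite T" "T \<subseteq> S" "\<forall>w\<in>T. c w \<in> quad_ring \<Delta>"
    unfolding gen_ideal_def by blast
  have "k * x = (\<Sum>w\<in>T. (k * c w) * w)" by (simp add: x(1) sum_distrib_left mult.assoc)
  then show "k * x \<in> gen_ideal \<Delta> S"
    unfolding gen_ideal_def using x(2-4) mult_in_quad_ring[OF k]
    by (intro CollectI exI[of _ T] exI[of _ "\<lambda>w. k * c w"]) auto
qed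

lemma integral_ideal_add_subgroup:
  assumes "integral_ideal \<Delta> I"
  shows "add_subgroup I"
  using assms gen_ideal_zero gen_ideal_diff
  unfolding integral_ideal_def frac_ideal_def add_subgroup_def by auto

lemma integral_ideal_norm_pos:
  assumes I: "integral_ideal \<Delta> I"
  shows "ideal_norm \<Delta> I > 0"
proof -
  obtain S where S: "I = gen_ideal \<Delta> S" and "I \<noteq> {0}" "I \<subseteq> quad_ring \<Delta>"
    using I unfolding integral_ideal_def frac_ideal_def by blast
  moreover have "0 \<in> I" unfolding S by (rule gen_ideal_zero)
  ultimately obtain u where "u \<in> I" "u \<noteq> 0" by blast
  then show ?thesis
    using norm_pos[OF integral_ideal_add_subgroup[OF I] \<open>I \<subseteq> quad_ring \<Delta>\<close>] gen_ideal_mult S by blast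
qed

text \<open>Clearing the denominator gives \<open>w\<close> times \<open>J\<close> equal to
  \<open>u\<close> times \<open>I\<close>, where \<open>norm_scale\<close> applies to both sides.
  Minimality of the norm of \<open>I\<close> and its positivity then allow cancellation.\<close>

lemma reduced_scale_ge_1:
  assumes I: "reduced_ideal \<Delta> I" and J: "integral_ideal \<Delta> J"
    and u: "u \<in> quad_ring \<Delta>" "u \<noteq> 0" and w: "w \<in> quad_ring \<Delta>" "w \<noteq> 0"
    and eq: "J = (*) (u / w) ` I"
  shows "cmod w \<le> cmod u"
proof -
  have Ii: "integral_ideal \<Delta> I" using I unfolding reduced_ideal_def by blast
  have sub: "I \<subseteq> quad_ring \<Delta>" "J \<subseteq> quad_ring \<Delta>" using Ii J by (simp_all add: integral_ideal_def)
  have "u / w \<in> quad_field \<Delta> - {0}" using quotient_in_quad_field u w by simp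
  then have le: "ideal_norm \<Delta> I \<le> ideal_norm \<Delta> J"
    using I J eq unfolding reduced_ideal_def same_class_def by blast
  have "(*) w ` J = (*) u ` I" unfolding eq using w by (simp add: image_image)
  then have "(cmod w)\<^sup>2 * ideal_norm \<Delta> J = (cmod u)\<^sup>2 * ideal_norm \<Delta> I"
    using norm_scale[OF integral_ideal_add_subgroup[OF J] sub(2) w]
      norm_scale[OF integral_ideal_add_subgroup[OF Ii] sub(1) u] by simp
  moreover have "(cmod w)\<^sup>2 * ideal_norm \<Delta> I \<le> (cmod w)\<^sup>2 * ideal_norm \<Delta> J"
    using le by (intro mult_left_mono) auto
  ultimately have "(cmod w)\<^sup>2 \<le> (cmod u)\<^sup>2"
    using integral_ideal_norm_pos[OF Ii] by simp
  then show ?thesis by (rule power2_le_imp_le) simp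
qed

text \<open>Its norm is 1, the least possible value. This covers the initial column ideal of the
  algorithm and lets the covering property be applied to the whole order.\<close>

lemma reduced_quad_ring: "reduced_ideal \<Delta> (quad_ring \<Delta>)"
proof -
  let ?O = "quad_ring \<Delta>"
  have "{1, 0} \<subseteq> quad_field \<Delta>"
    using quotient_in_quad_field[OF one_in_quad_ring one_in_quad_ring]
      quotient_in_quad_field[OF zero_in_quad_ring one_in_quad_ring] by simp
  moreover have "?O \<noteq> {0}" using one_in_quad_ring[of \<Delta>] by (metis singletonD zero_neq_one)
  ultimately have "integral_ideal \<Delta> ?O"
    unfolding integral_ideal_def frac_ideal_def using gen_ideal_one by (metis finite.intros order_refl)
  moreover have "ideal_norm \<Delta> ?O = 1"
    unfolding ideal_norm_eq_index using index_principal[OF one_in_quad_ring] by simp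
  ultimately show ?thesis
    unfolding reduced_ideal_def using integral_ideal_norm_pos
    by (simp add: Suc_leI)
qed

text \<open>A point slightly farther than \<open>\<epsilon>\<close> from \<open>0\<close> is not covered by discs centred at \<open>0\<close>, so it lies
  in a disc centred at some \<open>a / b\<close> with \<open>a \<noteq> 0\<close>.\<close>

lemma admissible_lower_bound:
  assumes adm: "admissible \<Delta> B \<epsilon>" and \<mu>: "\<And>b. b \<in> B \<Longrightarrow> cmod b \<le> \<mu>"
  shows "1 \<le> 2 * \<epsilon> * \<mu>"
proof -
  let ?O = "quad_ring \<Delta>"
  have B: "B \<noteq> {}" "B \<subseteq> ?O - {0}" and \<epsilon>: "0 < \<epsilon>"
    using adm unfolding admissible_def by auto
  have "?O \<inter> B \<noteq> {}" using B by blast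
  then have cover: "UNIV = \<Union> {cball (a / b) (\<epsilon> / cmod b) | a b.
                  a \<in> inv_ideal \<Delta> ?O \<and> b \<in> ?O \<inter> B \<and>
                  reduced_ideal \<Delta> (gen_ideal \<Delta> ((*) a ` ?O \<union> (*) b ` inv_ideal \<Delta> ?O))}"
    using adm reduced_quad_ring unfolding admissible_def by blast
  have \<mu>1: "1 \<le> \<mu>"
    using B \<mu> norm_ge_1 by (metis DiffD1 DiffD2 all_not_in_conv insertI1 order_trans subsetD)
  have "1 \<le> 2 * \<epsilon> * \<mu> + e" if e: "e > 0" for e
  proof -
    \<comment> \<open>The offset is chosen so that
      \<open>\<mu> * t = \<epsilon> * \<mu> + e\<close>; the remaining \<epsilon> is absorbed by
      \<open>1 \<le> \<mu>\<close>.\<close>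
    define t where "t = \<epsilon> + e / \<mu>"
    have t: "\<epsilon> < t" using e \<mu>1 by (simp add: t_def)
    have "complex_of_real t \<in> \<Union> {cball (a / b) (\<epsilon> / cmod b) | a b.
                  a \<in> inv_ideal \<Delta> ?O \<and> b \<in> ?O \<inter> B \<and>
                  reduced_ideal \<Delta> (gen_ideal \<Delta> ((*) a ` ?O \<union> (*) b ` inv_ideal \<Delta> ?O))}"
      using cover by blast
    then obtain a b where a: "a \<in> inv_ideal \<Delta> ?O" and b: "b \<in> B"
      and ab: "complex_of_real t \<in> cball (a / b) (\<epsilon> / cmod b)" by blast
    have b0: "b \<noteq> 0" and b1: "1 \<le> cmod b" using b B norm_ge_1 by auto
    have "a * 1 \<in> ?O" using a one_in_quad_ring unfolding inv_ideal_def by blast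
    then have aO: "a \<in> ?O" by simp
    have "cmod (a - b * t) = cmod b * cmod (a / b - t)"
      using b0 by (simp add: norm_mult[symmetric] right_diff_distrib)
    also have "\<dots> \<le> cmod b * (\<epsilon> / cmod b)"
      using ab by (intro mult_left_mono) (auto simp: dist_norm)
    finally have d: "cmod (a - b * t) \<le> \<epsilon>" using b0 by simp
    have bt: "cmod (b * t) = cmod b * t" using t \<epsilon> by (simp add: norm_mult)
    have "a \<noteq> 0"
    proof
      assume "a = 0"
      then have "cmod b * t \<le> \<epsilon>" using d bt by simp
      moreover have "1 * t \<le> cmod b * t" using b1 t \<epsilon> by (intro mult_right_mono) auto
      ultimately show False using t by simp
    qed
    then have "1 \<le> cmod a" using norm_ge_1 aO by blast
    also have "\<dots> \<le> cmod (a - b * t) + cmod (b * t)" using norm_triangle_sub[of a "b * t"] by simp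
    also have "\<dots> \<le> \<epsilon> + \<mu> * t"
      using d bt \<mu>[OF b] t \<epsilon> by (intro add_mono) (auto intro: mult_right_mono)
    also have "\<dots> = \<epsilon> * 1 + \<epsilon> * \<mu> + e" using \<mu>1 by (simp add: t_def field_simps)
    also have "\<dots> \<le> 2 * \<epsilon> * \<mu> + e" using mult_left_mono[OF \<mu>1, of \<epsilon>] \<epsilon> by simp
    finally show ?thesis .
  qed
  then show ?thesis by (rule field_le_epsilon)
qed

end

section \<open>Growth of the denominators\<close>

lemma norm_shrink_iterate:
  fixes r :: "nat \<Rightarrow> 'a::real_normed_vector"
  assumes "0 < \<epsilon>" and "\<And>k. k < n \<Longrightarrow> norm (r (Suc k)) \<le> \<epsilon> * norm (r k)" and "k + d \<le> n"
  shows "norm (r (k + d)) \<le> \<epsilon> ^ d * norm (r k)"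
  using assms(3)
proof (induction d)
  case (Suc d)
  have "norm (r (k + Suc d)) \<le> \<epsilon> * norm (r (k + d))" using assms(2)[of "k + d"] Suc.prems by simp
  also have "\<dots> \<le> \<epsilon> * (\<epsilon> ^ d * norm (r k))" using Suc assms(1) by (intro mult_left_mono) auto
  finally show ?case by simp
qed simp

text \<open>The bound is the fixed point of the map sending \<open>x\<close> to
  \<open>\<mu> + \<epsilon>\<^sup>2 * x\<close>. The factor \<open>\<epsilon>\<^sup>2\<close> comes
  from two shrinking steps, from \<open>r k\<close> to \<open>r (k + 2)\<close>.\<close>

lemma denominator_upper_bound:
  fixes q r :: "nat \<Rightarrow> complex"
  assumes \<epsilon>: "0 < \<epsilon>" "\<epsilon> < 1" and \<mu>: "0 < \<mu>" and q0: "q 0 = 0"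
    and shrink: "\<And>k. k < n \<Longrightarrow> norm (r (Suc k)) \<le> \<epsilon> * norm (r k)"
    and cross: "\<And>k. k < n \<Longrightarrow> norm (q (Suc k) * r k - q k * r (Suc k)) \<le> \<mu>"
    and "k < n"
  shows "norm (q (Suc k)) * norm (r k) < \<mu> / (1 - \<epsilon>\<^sup>2)"
  using assms(7)
proof (induction k)
  case 0
  have e: "0 < \<epsilon>\<^sup>2" "\<epsilon>\<^sup>2 < 1" using \<epsilon> by (simp_all add: power_less_one_iff)
  have "norm (q 1) * norm (r 0) \<le> \<mu>" using cross[OF 0] by (simp add: q0 norm_mult)
  also have "\<mu> < \<mu> / (1 - \<epsilon>\<^sup>2)" using e \<mu> by (simp add: field_simps)
  finally show ?case by simp
next
  case (Suc k)
  have e: "0 < \<epsilon>\<^sup>2" "\<epsilon>\<^sup>2 < 1" using \<epsilon> by (simp_all add: power_less_one_iff)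
  let ?Q = "q (Suc (Suc k)) * r (Suc k)" and ?P = "q (Suc k) * r (Suc (Suc k))"
  have "norm (r (k + 2)) \<le> \<epsilon>\<^sup>2 * norm (r k)"
    using norm_shrink_iterate[of \<epsilon> n r k 2, OF \<epsilon>(1) shrink] Suc.prems by simp
  then have "norm ?P \<le> norm (q (Suc k)) * (\<epsilon>\<^sup>2 * norm (r k))"
    by (simp add: norm_mult mult_left_mono)
  also have "\<dots> = \<epsilon>\<^sup>2 * (norm (q (Suc k)) * norm (r k))" by simp
  also have "\<dots> < \<epsilon>\<^sup>2 * (\<mu> / (1 - \<epsilon>\<^sup>2))" using Suc e by (intro mult_strict_left_mono) auto
  finally have P: "norm ?P < \<epsilon>\<^sup>2 * (\<mu> / (1 - \<epsilon>\<^sup>2))" .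
  have "norm ?Q \<le> norm (?Q - ?P) + norm ?P" using norm_triangle_sub[of ?Q ?P] by simp
  also have "\<dots> < \<mu> + \<epsilon>\<^sup>2 * (\<mu> / (1 - \<epsilon>\<^sup>2))" using P cross[OF Suc.prems] by simp
  also have "\<dots> = \<mu> / (1 - \<epsilon>\<^sup>2)" using e by (simp add: field_simps)
  finally show ?case by (simp add: norm_mult)
qed

text \<open>For the largest \<open>m < n\<close> with \<open>|q m * r n| \<le> 1/2\<close>, the gap condition gives
  \<open>|q n * r m| \<ge> 1/2\<close>. If \<open>m < n - 1\<close>, maximality bounds \<open>|q (m + 1)|\<close> from below, and the
  upper bound for denominators turns this into a comparison of \<open>r m\<close> with \<open>r n\<close>.\<close>

lemma denominator_lower_bound:
  fixes q r :: "nat \<Rightarrow> complex"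
  assumes \<epsilon>: "0 < \<epsilon>" "\<epsilon> < 1" and \<mu>: "1 \<le> 2 * \<epsilon> * \<mu>" and q0: "q 0 = 0"
    and nz: "\<And>k. k < n \<Longrightarrow> r k \<noteq> 0"
    and shrink: "\<And>k. k < n \<Longrightarrow> norm (r (Suc k)) \<le> \<epsilon> * norm (r k)"
    and cross: "\<And>k. k < n \<Longrightarrow> norm (q (Suc k) * r k - q k * r (Suc k)) \<le> \<mu>"
    and gap: "\<And>k. k < n \<Longrightarrow> 1 \<le> norm (q n * r k - q k * r n)"
    and k: "k < n"
  shows "(1 - \<epsilon>\<^sup>2) / (4 * \<epsilon> ^ (n - k) * \<mu>) \<le> norm (q n) * norm (r k)"
proof -
  have e: "0 < \<epsilon>\<^sup>2" "\<epsilon>\<^sup>2 < 1" using \<epsilon> by (simp_all add: power_less_one_iff)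
  have \<mu>0: "0 < \<mu>"
    using \<mu> \<epsilon> zero_less_mult_pos[of "2 * \<epsilon>" \<mu>] by simp
  define X where "X = {m. m < n \<and> norm (q m * r n) \<le> 1/2}"
  have X: "finite X" "X \<noteq> {}" using k q0 by (auto simp: X_def intro!: exI[of _ 0])
  define m where "m = Max X"
  have m: "m < n" "norm (q m * r n) \<le> 1/2" using Max_in[OF X] by (auto simp: m_def X_def)
  have max: "norm (q j * r n) > 1/2" if "m < j" "j < n" for j
  proof (rule ccontr)
    assume "\<not> norm (q j * r n) > 1/2"
    then have "j \<in> X" using that by (simp add: X_def)
    then show False using Max_ge[OF X(1), of j] that by (simp add: m_def)
  qed
  have half: "1/2 \<le> norm (q n) * norm (r m)"
    using gap[OF m(1)] norm_triangle_ineq4[of "q n * r m" "q m * r n"] m(2)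
    by (simp add: norm_mult)
  have rk: "0 < norm (r k)" using nz k by simp
  show ?thesis
  proof (cases "Suc m = n")
    case True
    have d: "n - k = Suc (m - k)" "k + (m - k) = m" using True k by auto
    have "norm (r (k + (m - k))) \<le> \<epsilon> ^ (m - k) * norm (r k)"
      by (rule norm_shrink_iterate[of _ n]) (use \<epsilon>(1) shrink True k in auto)
    then have "norm (q n) * norm (r m) \<le> norm (q n) * (\<epsilon> ^ (m - k) * norm (r k))"
      unfolding d by (intro mult_left_mono) auto
    with half have h: "1/2 \<le> \<epsilon> ^ (m - k) * (norm (q n) * norm (r k))" by (simp add: mult_ac)
    have "1 - \<epsilon>\<^sup>2 \<le> 2 * \<epsilon> * \<mu>" using e \<mu> by linarith
    also have "\<dots> = (4 * \<epsilon> * \<mu>) * (1/2)" by simp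
    also have "\<dots> \<le> (4 * \<epsilon> * \<mu>) * (\<epsilon> ^ (m - k) * (norm (q n) * norm (r k)))"
      using h \<epsilon> \<mu>0 by (intro mult_left_mono) auto
    also have "\<dots> = (norm (q n) * norm (r k)) * (4 * \<epsilon> ^ (n - k) * \<mu>)" unfolding d by simp
    finally show ?thesis using \<epsilon> \<mu>0 by (simp add: pos_divide_le_eq)
  next
    case False
    then have mn: "Suc m < n" using m(1) by simp
    have "norm (q (Suc m)) * norm (r m) < \<mu> / (1 - \<epsilon>\<^sup>2)"
      by (rule denominator_upper_bound[of \<epsilon> \<mu> q n r]) (use \<epsilon> \<mu>0 q0 shrink cross m in auto)
    then have u: "norm (q (Suc m)) * norm (r m) * (1 - \<epsilon>\<^sup>2) \<le> \<mu>"
      using e by (simp add: pos_less_divide_eq)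
    have l: "1/2 \<le> norm (q (Suc m)) * norm (r n)"
      using max[OF _ mn] by (simp add: norm_mult)
    have d: "norm (r n) \<le> \<epsilon> ^ (n - k) * norm (r k)"
      using norm_shrink_iterate[of \<epsilon> n r k "n - k", OF \<epsilon>(1) shrink] k by simp
    let ?s = "norm (q (Suc m))" and ?Q = "norm (q n)"
    have "1/2 * (1/2) \<le> (?s * norm (r n)) * (?Q * norm (r m))"
      by (intro mult_mono l half) auto
    then have "(1 - \<epsilon>\<^sup>2) * (1/2 * (1/2)) \<le> (1 - \<epsilon>\<^sup>2) * ((?s * norm (r n)) * (?Q * norm (r m)))"
      using e by (intro mult_left_mono) auto
    \<comment> \<open>Regrouping pairs \<open>?s\<close> with \<open>r m\<close>, a product of the
      kind bounded by \<open>denominator_upper_bound\<close>, and leaves \<open>?Q\<close> with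
      \<open>r n\<close>.\<close>
    also have "\<dots> = (?s * norm (r m) * (1 - \<epsilon>\<^sup>2)) * (?Q * norm (r n))" by simp
    also have "\<dots> \<le> \<mu> * (?Q * norm (r n))" using u by (intro mult_right_mono) auto
    also have "\<dots> \<le> \<mu> * (?Q * (\<epsilon> ^ (n - k) * norm (r k)))"
      using d \<mu>0 by (intro mult_left_mono) auto
    finally have "1 - \<epsilon>\<^sup>2 \<le> (?Q * norm (r k)) * (4 * \<epsilon> ^ (n - k) * \<mu>)" by (simp add: mult_ac)
    then show ?thesis using \<epsilon> \<mu>0 by (simp add: pos_divide_le_eq)
  qed
qed

section \<open>The continued fraction algorithm\<close>

text \<open>The inverse is the adjugate divided by the determinant. At the pole both sides are 0, so
  \<open>z\<close> needs no case distinction.\<close>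

lemma mat_act_matrix_inv:
  fixes A :: "complex^2^2"
  assumes "det A \<noteq> 0"
  shows "mat_act (matrix_inv A) z = (A$2$2 * z - A$1$2) / (A$1$1 - A$2$1 * z)"
proof -
  define D where "D = det A"
  have D: "D = A$1$1 * A$2$2 - A$1$2 * A$2$1" "D \<noteq> 0" using assms by (simp_all add: D_def det_2)
  define C :: "complex^2^2"
    where "C = vector [vector [A$2$2 / D, - A$1$2 / D], vector [- A$2$1 / D, A$1$1 / D]]"
  have C: "A ** C = mat 1" "C ** A = mat 1"
    using D(2) by (simp_all add: C_def matrix_matrix_mult_def mat_def vec_eq_iff forall_2 sum_2
        field_simps) (simp_all add: D(1) field_simps)
  \<comment> \<open>\<open>matrix_inv\<close> is a choice among two-sided inverses; \<open>C\<close>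
    shows that one exists, and uniqueness identifies the two.\<close>
  have "A ** matrix_inv A = mat 1 \<and> matrix_inv A ** A = mat 1"
    unfolding matrix_inv_def by (rule someI[of _ C]) (simp add: C)
  then have "matrix_inv A = C" by (metis C(2) matrix_mul_assoc matrix_mul_lid matrix_mul_rid)
  then have "mat_act (matrix_inv A) z
      = (A$2$2 / D * z + - A$1$2 / D) / (- A$2$1 / D * z + A$1$1 / D)"
    by (simp add: mat_act_def moebius_def C_def)
  also have "\<dots> = ((A$2$2 * z - A$1$2) / D) / ((A$1$1 - A$2$1 * z) / D)"
    by (simp add: diff_divide_distrib)
  also have "\<dots> = (A$2$2 * z - A$1$2) / (A$1$1 - A$2$1 * z)" using D(2) by simp
  finally show ?thesis .
qed

definition cf_r :: "(nat \<Rightarrow> complex^2^2) \<Rightarrow> complex \<Rightarrow> nat \<Rightarrow> complex" where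
  "cf_r M z n = M n $ 2 $ 1 * z - M n $ 1 $ 1"

locale cf_algorithm = quad_order +
  fixes B :: "complex set" and \<epsilon> :: real and z :: complex and N :: enat
    and a b :: "nat \<Rightarrow> complex" and M :: "nat \<Rightarrow> complex^2^2"
  assumes adm: "admissible \<Delta> B \<epsilon>" and run: "cf_run \<Delta> B \<epsilon> z N a b M"
begin

lemma eps_pos: "0 < \<epsilon>" and eps_less_1: "\<epsilon> < 1"
  using adm by (auto simp: admissible_def)

lemma B_norm_ge_1: "x \<in> B \<Longrightarrow> 1 \<le> cmod x"
  using adm norm_ge_1 by (auto simp: admissible_def)

lemma step:
  assumes "enat (Suc k) \<le> N"
  shows "\<not> cf_stop z (M k)" and "b (Suc k) \<in> B"
    and "cmod (b (Suc k) * mat_act (matrix_inv (M k)) z - a (Suc k)) \<le> \<epsilon> * cmod (b k)"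
    and "M (Suc k) = M k ** S_mat (a (Suc k) / b k) (b (Suc k) / b k)"
    and "reduced_ideal \<Delta> (col1_ideal \<Delta> (M (Suc k)))"
proof -
  have "\<forall>n\<ge>1. enat n \<le> N \<longrightarrow> \<not> cf_stop z (M (n - 1)) \<and> b n \<in> B \<and>
      a n \<in> quad_ring \<Delta> \<inter>
        cball (b n * mat_act (matrix_inv (M (n - 1))) z) (\<epsilon> * cmod (b (n - 1))) \<and>
      M n = M (n - 1) ** S_mat (a n / b (n - 1)) (b n / b (n - 1)) \<and>
      reduced_ideal \<Delta> (col1_ideal \<Delta> (M n))"
    using run unfolding cf_run_def by blast
  from this[THEN spec, of "Suc k", simplified, unfolded dist_norm] assms
  show "\<not> cf_stop z (M k)" "b (Suc k) \<in> B"
    "cmod (b (Suc k) * mat_act (matrix_inv (M k)) z - a (Suc k)) \<le> \<epsilon> * cmod (b k)"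
    "M (Suc k) = M k ** S_mat (a (Suc k) / b k) (b (Suc k) / b k)"
    "reduced_ideal \<Delta> (col1_ideal \<Delta> (M (Suc k)))"
    by blast+
qed

lemma step_entries:
  assumes "enat (Suc k) \<le> N"
  shows "M (Suc k) $ 1 $ 1 = M k $ 1 $ 1 * (a (Suc k) / b k) + M k $ 1 $ 2 * (b (Suc k) / b k)"
    and "M (Suc k) $ 2 $ 1 = M k $ 2 $ 1 * (a (Suc k) / b k) + M k $ 2 $ 2 * (b (Suc k) / b k)"
    and "M (Suc k) $ 1 $ 2 = M k $ 1 $ 1" and "M (Suc k) $ 2 $ 2 = M k $ 2 $ 1"
  unfolding step(4)[OF assms] by (simp_all add: matrix_matrix_mult_def S_mat_def sum_2)

lemma init: "M 0 = mat 1" "b 0 = 1"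
  using run by (simp_all add: cf_run_def)

lemma b_nonzero:
  assumes "enat k \<le> N"
  shows "b k \<noteq> 0"
proof (cases k)
  case 0
  then show ?thesis using init by simp
next
  case (Suc j)
  then show ?thesis using step(2)[of j] assms B_norm_ge_1 by fastforce
qed

lemma enat_Suc_leD: "enat (Suc k) \<le> N \<Longrightarrow> enat k \<le> N"
  by (meson enat_ord_simps(1) le_SucI order_refl order_trans)

text \<open>Each step multiplies the determinant by \<open>- b (Suc k) / b k\<close>, so the product
  telescopes.\<close>

lemma det_M: "enat k \<le> N \<Longrightarrow> det (M k) = (- 1) ^ k * b k"
proof (induction k)
  case 0
  then show ?case using init by simp
next
  case (Suc k)
  have "det (M (Suc k)) = - det (M k) * (b (Suc k) / b k)"
    unfolding det_2 step_entries[OF Suc.prems] by (simp add: algebra_simps)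
  then show ?case using Suc b_nonzero[OF enat_Suc_leD[OF Suc.prems]] enat_Suc_leD by simp
qed

lemma det_M_nonzero: "enat k \<le> N \<Longrightarrow> det (M k) \<noteq> 0"
  using det_M b_nonzero by simp

text \<open>A zero would either trigger the stopping rule before step \<open>Suc k\<close> or make
  the first column of an invertible matrix vanish.\<close>

lemma r_nonzero:
  assumes "enat (Suc k) \<le> N"
  shows "cf_r M z k \<noteq> 0"
proof
  assume r: "cf_r M z k = 0"
  have d: "M k $ 1 $ 1 * M k $ 2 $ 2 - M k $ 1 $ 2 * M k $ 2 $ 1 \<noteq> 0"
    using det_M_nonzero[OF enat_Suc_leD[OF assms]] by (simp add: det_2)
  show False
  proof (cases "M k $ 2 $ 1 = 0")
    case True
    then show ?thesis using r d by (simp add: cf_r_def)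
  next
    case False
    then have "cf_stop z (M k)" using r by (simp add: cf_stop_def cf_r_def field_simps)
    then show ?thesis using step(1)[OF assms] by blast
  qed
qed

lemma cf_z_eq: "enat k \<le> N \<Longrightarrow> cf_z M z k = (M k $ 2 $ 2 * z - M k $ 1 $ 2) / - cf_r M z k"
  unfolding cf_z_def cf_r_def minus_diff_eq by (rule mat_act_matrix_inv[OF det_M_nonzero])

text \<open>The quotient of consecutive values of \<open>cf_r\<close> is, up to sign,
  \<open>(b (Suc k) * cf_z M z k - a (Suc k)) / b k\<close>, so the disc condition on
  \<open>a (Suc k)\<close> is exactly this contraction.\<close>

lemma r_shrink:
  assumes "enat (Suc k) \<le> N"
  shows "cmod (cf_r M z (Suc k)) \<le> \<epsilon> * cmod (cf_r M z k)"
proof -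
  have k: "enat k \<le> N" using enat_Suc_leD[OF assms] .
  let ?r = "cf_r M z k" and ?s = "M k $ 2 $ 2 * z - M k $ 1 $ 2"
  have s: "?s = - cf_z M z k * ?r" using cf_z_eq[OF k] r_nonzero[OF assms] by simp
  have "cf_r M z (Suc k) = (?r * a (Suc k) + ?s * b (Suc k)) / b k"
    by (simp add: cf_r_def step_entries[OF assms] add_divide_distrib diff_divide_distrib algebra_simps)
  also have "\<dots> = - ((b (Suc k) * cf_z M z k - a (Suc k)) / b k) * ?r"
    unfolding s using b_nonzero[OF k] by (simp add: field_simps)
  finally have "cmod (cf_r M z (Suc k)) = cmod (b (Suc k) * cf_z M z k - a (Suc k)) / cmod (b k) * cmod ?r"
    by (simp add: norm_mult norm_divide)
  also have "\<dots> \<le> \<epsilon> * cmod ?r"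
    using step(3)[OF assms] b_nonzero[OF k]
    by (intro mult_right_mono) (auto simp: cf_z_def pos_divide_le_eq)
  finally show ?thesis .
qed

text \<open>The second column of \<open>M (Suc k)\<close> is the first column of \<open>M k\<close>,
  so the numerator of \<open>cf_z M z (Suc k)\<close> is \<open>cf_r M z k\<close>.\<close>

lemma z_times_r:
  assumes "enat (Suc (Suc k)) \<le> N"
  shows "cmod (cf_z M z (Suc k)) * cmod (cf_r M z (Suc k)) = cmod (cf_r M z k)"
proof -
  have k: "enat (Suc k) \<le> N" using enat_Suc_leD[OF assms] .
  have "cf_z M z (Suc k) * cf_r M z (Suc k) = - cf_r M z k"
    unfolding cf_z_eq[OF k] using r_nonzero[OF assms]
    by (simp add: cf_r_def[of M z k] step_entries[OF k])
  then show ?thesis by (metis norm_minus_cancel norm_mult)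
qed

text \<open>The terms containing \<open>z\<close> cancel, and what remains is the determinant of
  \<open>M (Suc k)\<close>.\<close>

lemma cross_det:
  assumes "enat (Suc k) \<le> N"
  shows "cmod (cf_q M (Suc k) * cf_r M z k - cf_q M k * cf_r M z (Suc k)) = cmod (b (Suc k))"
proof -
  have "cf_q M (Suc k) * cf_r M z k - cf_q M k * cf_r M z (Suc k) = det (M (Suc k))"
    unfolding det_2 step_entries(3,4)[OF assms] cf_q_def cf_r_def by (simp add: algebra_simps)
  then show ?thesis using det_M[OF assms] by (simp add: norm_mult norm_power)
qed

lemma r_decreasing:
  assumes "m < n" "enat n \<le> N"
  shows "cmod (cf_r M z n) < cmod (cf_r M z m)"
proof -
  have le: "enat (Suc j) \<le> N" if "j < n" for j
    using that assms(2) by (meson Suc_leI enat_ord_simps(1) order_trans)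
  have "cmod (cf_r M z (m + (n - m))) \<le> \<epsilon> ^ (n - m) * cmod (cf_r M z m)"
    by (rule norm_shrink_iterate[of _ n]) (use eps_pos r_shrink le assms(1) in auto)
  also have "\<dots> < 1 * cmod (cf_r M z m)"
    using r_nonzero[OF le[OF assms(1)]] eps_pos eps_less_1 assms(1)
    by (intro mult_strict_right_mono) (auto simp: power_less_one_iff)
  finally show ?thesis using assms(1) by simp
qed

text \<open>The recursion divides by \<open>b k\<close>, so integrality is read off from the column
  ideal instead: it is reduced, hence integral, and contains its generators.\<close>

lemma entries_in_quad_ring:
  assumes "enat k \<le> N"
  shows "M k $ 1 $ 1 \<in> quad_ring \<Delta>" "M k $ 2 $ 1 \<in> quad_ring \<Delta>"
proof -
  have "M k $ 1 $ 1 \<in> quad_ring \<Delta> \<and> M k $ 2 $ 1 \<in> quad_ring \<Delta>"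
  proof (cases k)
    case 0
    then show ?thesis using init zero_in_quad_ring one_in_quad_ring by (simp add: mat_def)
  next
    case (Suc j)
    then have "gen_ideal \<Delta> {M k $ 1 $ 1, M k $ 2 $ 1} \<subseteq> quad_ring \<Delta>"
      using step(5)[of j] assms by (simp add: reduced_ideal_def integral_ideal_def col1_ideal_def)
    then show ?thesis using generators_in_gen_ideal by blast
  qed
  then show "M k $ 1 $ 1 \<in> quad_ring \<Delta>" "M k $ 2 $ 1 \<in> quad_ring \<Delta>" by auto
qed

lemma reduced_col1:
  assumes "enat k \<le> N"
  shows "reduced_ideal \<Delta> (gen_ideal \<Delta> {M k $ 1 $ 1, M k $ 2 $ 1})"
proof (cases k)
  case 0
  then show ?thesis using init reduced_quad_ring gen_ideal_one by (simp add: mat_def)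
next
  case (Suc j)
  then show ?thesis using step(5)[of j] assms by (simp add: col1_ideal_def)
qed

text \<open>Proportional first columns would generate two reduced ideals of one class, whose norms
  agree, while the proportionality factor has absolute value \<open>|r n| / |r m| < 1\<close>.\<close>

lemma gap:
  assumes mn: "m < n" and n: "enat n \<le> N"
  shows "1 \<le> cmod (cf_q M n * cf_r M z m - cf_q M m * cf_r M z n)"
proof -
  have m1: "enat (Suc m) \<le> N" using mn n by (meson Suc_leI enat_ord_simps(1) order_trans)
  have m: "enat m \<le> N" using enat_Suc_leD[OF m1] .
  let ?p = "M m $ 1 $ 1" and ?q = "M m $ 2 $ 1" and ?p' = "M n $ 1 $ 1" and ?q' = "M n $ 2 $ 1"
  note O = entries_in_quad_ring[OF m] entries_in_quad_ring[OF n]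
  have nonprop: False if u: "u \<in> quad_ring \<Delta>" and w: "w \<in> quad_ring \<Delta>" "w \<noteq> 0"
    and pq: "?p' = u / w * ?p" "?q' = u / w * ?q" for u w
  proof -
    have "u \<noteq> 0" using pq det_M_nonzero[OF n] by (auto simp: det_2)
    moreover have "integral_ideal \<Delta> (gen_ideal \<Delta> {?p', ?q'})"
      using reduced_col1[OF n] by (simp add: reduced_ideal_def)
    moreover have "gen_ideal \<Delta> {?p', ?q'} = (*) (u / w) ` gen_ideal \<Delta> {?p, ?q}"
      unfolding pq by (rule gen_ideal_scale)
    ultimately have "cmod w \<le> cmod u"
      using reduced_scale_ge_1[OF reduced_col1[OF m] _ u _ w] by blast
    then have "1 \<le> cmod (u / w)" using w by (simp add: norm_divide)
    then have "1 * cmod (cf_r M z m) \<le> cmod (u / w) * cmod (cf_r M z m)"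
      by (intro mult_right_mono) auto
    also have "\<dots> = cmod (cf_r M z n)"
      unfolding norm_mult[symmetric] cf_r_def pq by (simp add: algebra_simps)
    finally show False using r_decreasing[OF mn n] by simp
  qed
  have "?q * ?p' - ?q' * ?p \<noteq> 0"
  proof
    assume eq: "?q * ?p' - ?q' * ?p = 0"
    show False
    \<comment> \<open>The proportionality factor is \<open>?p' / ?p\<close> if
      \<open>?q = 0\<close>, and \<open>?q' / ?q\<close> otherwise.\<close>
    proof (cases "?q = 0")
      case True
      then have p: "?p \<noteq> 0" using det_M_nonzero[OF m] by (auto simp: det_2)
      then have "?q' = 0" using eq True by simp
      then show False using nonprop[OF O(3) O(1)] p True by simp
    next
      case False
      then show False using nonprop[OF O(4) O(2)] eq by (simp add: field_simps)
    qed
  qed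
  moreover have "?q * ?p' - ?q' * ?p \<in> quad_ring \<Delta>"
    using O by (intro diff_in_quad_ring mult_in_quad_ring)
  ultimately have "1 \<le> cmod (?q * ?p' - ?q' * ?p)" using norm_ge_1 by blast
  moreover have "cf_q M n * cf_r M z m - cf_q M m * cf_r M z n = ?q * ?p' - ?q' * ?p"
    by (simp add: cf_q_def cf_r_def algebra_simps)
  ultimately show ?thesis by simp
qed

section \<open>Estimates in terms of an upper bound for the moduli of elements of
  \<open>B\<close>\<close>

context
  fixes \<mu> :: real
  assumes \<mu>: "\<And>x. x \<in> B \<Longrightarrow> cmod x \<le> \<mu>"
begin

lemma mu_ge_1: "1 \<le> \<mu>"
proof -
  obtain x where "x \<in> B" using adm by (auto simp: admissible_def)
  then show ?thesis using \<mu> B_norm_ge_1 order_trans by blast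
qed

lemma q_r_lower_bound:
  assumes "k < n" "enat n \<le> N"
  shows "(1 - \<epsilon>\<^sup>2) / (4 * \<epsilon> ^ (n - k) * \<mu>) \<le> cmod (cf_q M n) * cmod (cf_r M z k)"
proof -
  have le: "enat (Suc j) \<le> N" if "j < n" for j
    using that assms(2) by (meson Suc_leI enat_ord_simps(1) order_trans)
  have q0: "cf_q M 0 = 0" by (simp add: cf_q_def init mat_def)
  have cross: "cmod (cf_q M (Suc j) * cf_r M z j - cf_q M j * cf_r M z (Suc j)) \<le> \<mu>" if "j < n" for j
    using cross_det[OF le[OF that]] \<mu>[OF step(2)[OF le[OF that]]] by simp
  show ?thesis
    by (rule denominator_lower_bound[where q = "cf_q M" and r = "cf_r M z", OF eps_pos eps_less_1
          admissible_lower_bound[OF adm \<mu>] q0 r_nonzero[OF le] r_shrink[OF le] cross gap[OF _ assms(2)] assms(1)])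
qed

text \<open>For positive \<open>k\<close>, \<open>z_times_r\<close> turns the left side into the
  product treated by \<open>denominator_upper_bound\<close>; for \<open>k = 0\<close> it vanishes
  because \<open>cf_q M 0 = 0\<close>.\<close>

lemma q_z_r_upper_bound:
  assumes "enat (Suc k) \<le> N"
  shows "cmod (cf_q M k * cf_z M z k) * cmod (cf_r M z k) < \<mu> / (1 - \<epsilon>\<^sup>2)"
proof (cases k)
  case 0
  have "\<epsilon>\<^sup>2 < 1" using eps_pos eps_less_1 by (simp add: power_less_one_iff)
  then show ?thesis using 0 mu_ge_1 by (simp add: cf_q_def init mat_def)
next
  case (Suc j)
  have le: "enat (Suc i) \<le> N" if "i < k" for i
    using that assms by (meson Suc_leI enat_ord_simps(1) less_imp_le less_SucI order_trans)
  have q0: "cf_q M 0 = 0" by (simp add: cf_q_def init mat_def)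
  have mu_pos: "0 < \<mu>" using mu_ge_1 by simp
  have cross: "cmod (cf_q M (Suc i) * cf_r M z i - cf_q M i * cf_r M z (Suc i)) \<le> \<mu>" if "i < k" for i
    using cross_det[OF le[OF that]] \<mu>[OF step(2)[OF le[OF that]]] by simp
  have "cmod (cf_q M (Suc j)) * cmod (cf_r M z j) < \<mu> / (1 - \<epsilon>\<^sup>2)"
    by (rule denominator_upper_bound[where n = k, OF eps_pos eps_less_1 mu_pos q0 r_shrink[OF le] cross])
      (use Suc in auto)
  then show ?thesis using z_times_r[of j] assms Suc by (simp add: norm_mult mult.assoc)
qed

end

end

theorem theorem4p9:
  fixes \<Delta> :: int and B :: "complex set" and \<epsilon> \<mu> :: real and z :: complex and N :: enat
    and a b :: "nat \<Rightarrow> complex" and M :: "nat \<Rightarrow> complex^2^2"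
  assumes "\<Delta> < 0" and "\<Delta> mod 4 \<in> {0, 1}"
    and "admissible \<Delta> B \<epsilon>"
    and "\<mu> = Max (cmod ` B)"
    and "cf_run \<Delta> B \<epsilon> z N a b M"
  shows "(\<forall>n' n. n' < n \<and> enat n \<le> N \<longrightarrow>
            cmod (cf_q M n) >
              (1 - \<epsilon>\<^sup>2)\<^sup>2 * cmod (cf_q M n' * cf_z M z n') / (4 * \<epsilon> ^ (n - n') * \<mu>\<^sup>2)) \<and>
         (\<forall>n\<ge>1. enat n \<le> N \<longrightarrow>
            cmod (cf_q M n) > (1 - \<epsilon>\<^sup>2)\<^sup>2 / (4 * \<epsilon> ^ n * \<mu>\<^sup>2))"
proof -
  interpret cf_algorithm \<Delta> B \<epsilon> z N a b M
    using assms by unfold_locales auto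
  have "finite B" using assms(3) by (simp add: admissible_def)
  then have \<mu>: "cmod x \<le> \<mu>" if "x \<in> B" for x using that by (simp add: assms(4))
  have \<mu>1: "1 \<le> \<mu>" using mu_ge_1[OF \<mu>] .
  have e: "0 < \<epsilon>\<^sup>2" "\<epsilon>\<^sup>2 < 1" using eps_pos eps_less_1 by (simp_all add: power_less_one_iff)
  show ?thesis
  proof (intro conjI allI impI)
    fix n' n assume "n' < n \<and> enat n \<le> N"
    then have n: "n' < n" "enat n \<le> N" by auto
    have n1: "enat (Suc n') \<le> N" using n by (meson Suc_leI enat_ord_simps(1) order_trans)
    define R where "R = cmod (cf_r M z n')"
    define x where "x = cmod (cf_q M n' * cf_z M z n')"
    have R: "R > 0" using r_nonzero[OF n1] by (simp add: R_def)
    define E where "E = 4 * \<epsilon> ^ (n - n')"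
    have E: "E > 0" using eps_pos by (simp add: E_def)
    \<comment> \<open>The bounds for \<open>x * R\<close> and for \<open>cmod (cf_q M n) * R\<close>
      share the factor \<open>R\<close>. The multiplier in the next line carries the upper bound for
      the former to the lower bound for the latter, and then \<open>R\<close> cancels.\<close>
    have "x * R < \<mu> / (1 - \<epsilon>\<^sup>2)" using q_z_r_upper_bound[OF \<mu> n1] by (simp add: x_def R_def)
    then have "(1 - \<epsilon>\<^sup>2)\<^sup>2 / (E * \<mu>\<^sup>2) * (x * R) < (1 - \<epsilon>\<^sup>2)\<^sup>2 / (E * \<mu>\<^sup>2) * (\<mu> / (1 - \<epsilon>\<^sup>2))"
      using e E \<mu>1 by (intro mult_strict_left_mono) auto
    also have "\<dots> = (1 - \<epsilon>\<^sup>2) / (E * \<mu>)" using e \<mu>1 by (simp add: power2_eq_square)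
    also have "\<dots> \<le> cmod (cf_q M n) * R"
      using q_r_lower_bound[OF \<mu> n] by (simp add: E_def R_def)
    finally have "((1 - \<epsilon>\<^sup>2)\<^sup>2 * x / (E * \<mu>\<^sup>2)) * R < cmod (cf_q M n) * R" by (simp add: mult_ac)
    then have "(1 - \<epsilon>\<^sup>2)\<^sup>2 * x / (E * \<mu>\<^sup>2) < cmod (cf_q M n)"
      by (rule mult_right_less_imp_less) (use R in simp)
    then show "(1 - \<epsilon>\<^sup>2)\<^sup>2 * cmod (cf_q M n' * cf_z M z n') / (4 * \<epsilon> ^ (n - n') * \<mu>\<^sup>2) < cmod (cf_q M n)"
      by (simp add: E_def x_def)
  next
    fix n :: nat assume n: "1 \<le> n" "enat n \<le> N"
    \<comment> \<open>Taking \<open>n' = 0\<close> in the first claim only gives positivity, since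
      \<open>cf_q M 0 = 0\<close>. Instead \<open>q_r_lower_bound\<close> is used at index 0, where
      \<open>cf_r M z 0 = - 1\<close>; strictness comes from
      \<open>1 - \<epsilon>\<^sup>2 < 1 \<le> \<mu>\<close>.\<close>
    have "(1 - \<epsilon>\<^sup>2)\<^sup>2 < (1 - \<epsilon>\<^sup>2) * \<mu>"
      unfolding power2_eq_square[of "1 - \<epsilon>\<^sup>2"]
      by (intro mult_strict_left_mono) (use e \<mu>1 in linarith)+
    then have "(1 - \<epsilon>\<^sup>2)\<^sup>2 / (4 * \<epsilon> ^ n * \<mu>\<^sup>2) < (1 - \<epsilon>\<^sup>2) * \<mu> / (4 * \<epsilon> ^ n * \<mu>\<^sup>2)"
      using eps_pos \<mu>1 by (intro divide_strict_right_mono) auto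
    also have "\<dots> = (1 - \<epsilon>\<^sup>2) / (4 * \<epsilon> ^ (n - 0) * \<mu>)" using \<mu>1 by (simp add: power2_eq_square)
    also have "\<dots> \<le> cmod (cf_q M n) * cmod (cf_r M z 0)"
      by (rule q_r_lower_bound[OF \<mu>]) (use n in auto)
    also have "\<dots> = cmod (cf_q M n)" by (simp add: cf_r_def init mat_def)
    finally show "(1 - \<epsilon>\<^sup>2)\<^sup>2 / (4 * \<epsilon> ^ n * \<mu>\<^sup>2) < cmod (cf_q M n)" .
  qed
qed

end
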